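(* Let $n\ge 1$ and let $M\in\mathbb{R}^{n\times n}$ be symmetric positive semidefinite with $M_{j,j}=1$ for all $j=1,\dots,n$. Then $$ M\circ M\succeq \frac{1}{n}E_n . $$
   Context: A matrix $M\in\mathbb{R}^{n\times n}$ is positive semidefinite if it is symmetric and $c^TMc\ge 0$ for all $c\in\mathbb{R}^n$. $M\succeq N$ means that $M-N$ is positive semidefinite. $M\circ M$ is the Hadamard (entrywise) product, $(M\circ M)_{j,k}=M_{j,k}^2$. $E_n\in\mathbb{R}^{n\times n}$ is the matrix with all entries equal to one. *)

theory Defs
  imports "HOL-Analysis.Analysis"
begin

definition psd :: "real^'n^'n \<Rightarrow> bool" where
  "psd M \<longleftrightarrow> transpose M = M \<and> (\<forall>c. c \<bullet> (M *v c) \<ge> 0)"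

definition psd_ge :: "real^'n^'n \<Rightarrow> real^'n^'n \<Rightarrow> bool"  (infix "\<succeq>" 50) where
  "M \<succeq> N \<longleftrightarrow> psd (M - N)"

definition hadamard :: "real^'n^'n \<Rightarrow> real^'n^'n \<Rightarrow> real^'n^'n"  (infixl "\<circ>\<^sub>H" 70) where
  "A \<circ>\<^sub>H B = (\<chi> j k. A $ j $ k * B $ j $ k)"

definition ones_matrix :: "real^'n^'n" where
  "ones_matrix = (\<chi> j k. 1)"

end

theory Submission
  imports Defs
begin

text \<open>
  Write \<open>M\<close> as a Gram matrix, \<open>M $ j $ k = (\<Sum>i. v i $ j * v i $ k)\<close>, with as many vectors \<open>v i\<close> as
  the dimension \<open>n\<close> of \<open>M\<close>. For a vector \<open>c\<close> let \<open>B = A\<^sup>T D A\<close>, where \<open>A\<close> has the columns \<open>v i\<close> and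
  \<open>D\<close> is the diagonal matrix of \<open>c\<close>. Then the squared Frobenius norm of the \<open>n \<times> n\<close> matrix \<open>B\<close> is the
  quadratic form of \<open>M \<circ>\<^sub>H M\<close> at \<open>c\<close>, while the trace of \<open>B\<close> is \<open>\<Sum>j. c $ j * M $ j $ j\<close>, which is
  \<open>\<Sum>j. c $ j\<close> for a unit diagonal. The Cauchy-Schwarz inequality between \<open>B\<close> and the identity
  matrix, \<open>(tr B)\<^sup>2 \<le> n * \<parallel>B\<parallel>\<^sup>2\<close>, is therefore the claim.

  The number of Gram vectors is what produces the constant \<open>1 / n\<close>. They are found by symmetric
  Gaussian elimination (lemma \<open>psd_gram_on\<close>), whose elimination step keeps the matrix positive
  semidefinite because of the Cauchy-Schwarz inequality for the form of \<open>M\<close>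
  (lemma \<open>psd_Cauchy_Schwarz_axis\<close>).
\<close>

lemma psd_symD: "psd M \<Longrightarrow> M $ j $ k = M $ k $ j"
  by (simp add: psd_def vec_eq_iff transpose_def)

lemma inner_matrix_vector_sum:
  fixes M :: "real^'n^'n"
  shows "c \<bullet> (M *v c) = (\<Sum>j\<in>UNIV. \<Sum>k\<in>UNIV. c $ j * c $ k * M $ j $ k)"
  by (simp add: inner_vec_def matrix_vector_mult_def sum_distrib_left algebra_simps)

lemma psd_diag_nonneg:
  assumes "psd M"
  shows "0 \<le> M $ i $ i"
proof -
  have "axis i 1 \<bullet> (M *v axis i 1) = M $ i $ i"
    by (simp add: inner_axis' matrix_vector_mult_basis column_def)
  then show ?thesis using assms unfolding psd_def by metis
qed

lemma inner_rank_one_sum: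
  fixes c v :: "real^'n"
  shows "(\<Sum>j\<in>UNIV. \<Sum>k\<in>UNIV. c $ j * c $ k * (v $ j * v $ k)) = (c \<bullet> v)\<^sup>2"
  by (simp add: inner_vec_def power2_eq_square sum_product algebra_simps)

text \<open>
  The Cauchy-Schwarz inequality of the form of \<open>M\<close> for \<open>c\<close> and a standard basis vector: the form is
  nonnegative at every \<open>c - t *\<^sub>R axis i 1\<close>, which bounds a discriminant. It also covers
  \<open>M $ i $ i = 0\<close>, where it says that the whole row \<open>i\<close> vanishes.
\<close>

lemma psd_Cauchy_Schwarz_axis:
  fixes M :: "real^'n^'n"
  assumes "psd M"
  shows "((M *v c) $ i)\<^sup>2 \<le> M $ i $ i * (c \<bullet> (M *v c))"
proof -
  let ?a = "c \<bullet> (M *v c)" and ?b = "(M *v c) $ i" and ?d = "M $ i $ i"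
  have col: "(M *v axis i 1) $ k = M $ k $ i" for k
    by (simp add: matrix_vector_mult_basis column_def)
  have "c \<bullet> (M *v axis i 1) = (\<Sum>k\<in>UNIV. c $ k * M $ k $ i)"
    by (simp add: inner_vec_def col)
  also have "\<dots> = ?b"
    by (simp add: matrix_vector_mult_def psd_symD[OF assms, of _ i] mult.commute)
  finally have expand: "(c - t *\<^sub>R axis i 1) \<bullet> (M *v (c - t *\<^sub>R axis i 1)) = ?a - 2 * t * ?b + t\<^sup>2 * ?d"
    for t
    by (simp add: matrix_vector_mult_diff_distrib matrix_vector_mult_scaleR inner_diff_left
        inner_diff_right inner_axis' col power2_eq_square algebra_simps)
  have nonneg: "0 \<le> ?a - 2 * t * ?b + t\<^sup>2 * ?d" for t
    using assms expand[of t] unfolding psd_def by metis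
  show ?thesis
  proof (cases "?d = 0")
    case True
    have "?b = 0"
    proof (rule ccontr)
      assume "?b \<noteq> 0"
      \<comment> \<open>With \<open>?d = 0\<close> the expression is affine in \<open>t\<close>; this \<open>t\<close> gives it the value \<open>-1\<close>.\<close>
      then show False
        using nonneg[of "(?a + 1) / (2 * ?b)"] True by simp
    qed
    then show ?thesis using True by simp
  next
    case False
    then have "0 < ?d" using psd_diag_nonneg[OF assms, of i] by simp
    then show ?thesis
      using nonneg[of "?b / ?d"] by (simp add: field_simps power2_eq_square)
  qed
qed

text \<open>
  One step of symmetric Gaussian elimination. The Schur complement formula also serves the case
  \<open>M $ i $ i = 0\<close>: there row \<open>i\<close> is already zero, and division by zero makes the subtracted term zero.
\<close>

lemma psd_eliminate:
  fixes M :: "real^'n^'n" and i :: 'n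
  assumes "psd M"
  defines "N \<equiv> (\<chi> j k. M $ j $ k - M $ j $ i * M $ k $ i / M $ i $ i)"
  shows "psd N" and "N $ i $ k = 0"
proof -
  have "transpose N = N"
    by (simp add: N_def transpose_def vec_eq_iff psd_symD[OF assms(1)] mult.commute)
  moreover have "0 \<le> c \<bullet> (N *v c)" for c
  proof -
    have ci: "c \<bullet> (\<chi> j. M $ j $ i) = (M *v c) $ i"
      by (simp add: inner_vec_def matrix_vector_mult_def psd_symD[OF assms(1), of _ i] mult.commute)
    have "c \<bullet> (N *v c) = c \<bullet> (M *v c) - ((M *v c) $ i)\<^sup>2 / M $ i $ i"
      unfolding inner_matrix_vector_sum ci[symmetric] inner_rank_one_sum[symmetric]
      by (simp add: N_def sum_subtractf sum_divide_distrib algebra_simps)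
    moreover have "((M *v c) $ i)\<^sup>2 / M $ i $ i \<le> c \<bullet> (M *v c)"
      using psd_Cauchy_Schwarz_axis[OF assms(1), of c i] psd_diag_nonneg[OF assms(1), of i] assms(1)
      by (cases "M $ i $ i = 0") (auto simp: psd_def divide_le_eq mult.commute)
    ultimately show ?thesis by simp
  qed
  ultimately show "psd N" unfolding psd_def by blast
  show "N $ i $ k = 0"
  proof (cases "M $ i $ i = 0")
    case True
    then have "(M *v axis k 1) $ i = 0"
      using psd_Cauchy_Schwarz_axis[OF assms(1), of "axis k 1" i] by simp
    then show ?thesis
      using True by (simp add: N_def matrix_vector_mult_basis column_def)
  next
    case False
    then show ?thesis
      using psd_symD[OF assms(1), of i k] by (simp add: N_def)
  qed
qed

text \<open>
  Eliminating the indices of \<open>S\<close> one after another reaches the zero matrix, since rows that vanish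
  stay zero; each step contributes a single rank-one term.
\<close>

lemma psd_gram_on:
  fixes M :: "real^'n^'n"
  assumes "finite S" "psd M" "\<And>j k. j \<notin> S \<Longrightarrow> M $ j $ k = 0"
  shows "\<exists>v :: 'n \<Rightarrow> real^'n. \<forall>j k. M $ j $ k = (\<Sum>i\<in>S. v i $ j * v i $ k)"
  using assms
proof (induction S arbitrary: M rule: finite_induct)
  case empty
  then show ?case by simp
next
  case (insert i S)
  define N where "N = (\<chi> j k. M $ j $ k - M $ j $ i * M $ k $ i / M $ i $ i)"
  have "psd N"
    unfolding N_def by (rule psd_eliminate(1)[OF insert.prems(1)])
  have row: "N $ i $ k = 0" for k
    unfolding N_def by (rule psd_eliminate(2)[OF insert.prems(1)])
  have "N $ j $ k = 0" if "j \<notin> S" for j k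
  proof (cases "j = i")
    case True
    then show ?thesis by (simp only: row)
  next
    case False
    then have "M $ j $ k' = 0" for k'
      using that insert.prems(2)[of j k'] by simp
    then show ?thesis by (simp add: N_def)
  qed
  with \<open>psd N\<close> obtain v :: "'n \<Rightarrow> real^'n"
    where v: "\<And>j k. N $ j $ k = (\<Sum>l\<in>S. v l $ j * v l $ k)"
    using insert.IH by blast
  have M: "M $ j $ k = N $ j $ k + (M $ j $ i / sqrt (M $ i $ i)) * (M $ k $ i / sqrt (M $ i $ i))"
    for j k
    using psd_diag_nonneg[OF insert.prems(1), of i] by (simp add: N_def)
  define w where "w = v(i := (\<chi> j. M $ j $ i / sqrt (M $ i $ i)))"
  have "(\<Sum>l\<in>S. w l $ j * w l $ k) = (\<Sum>l\<in>S. v l $ j * v l $ k)" for j k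
    using insert.hyps(2) by (intro sum.cong) (auto simp: w_def)
  then have "M $ j $ k = (\<Sum>l\<in>insert i S. w l $ j * w l $ k)" for j k
    using insert.hyps M[of j k] v[of j k] by (simp add: w_def)
  then show ?case by blast
qed

corollary psd_gram:
  fixes M :: "real^'n^'n"
  assumes "psd M"
  obtains v :: "'n \<Rightarrow> real^'n" where "\<And>j k. M $ j $ k = (\<Sum>i\<in>UNIV. v i $ j * v i $ k)"
  using psd_gram_on[of UNIV M] assms by auto

text \<open>
  The Cauchy-Schwarz inequality between a square matrix and the identity, in the Frobenius inner
  product.
\<close>

lemma trace_square_le_frobenius:
  fixes B :: "'n::finite \<Rightarrow> 'n \<Rightarrow> real"
  shows "(\<Sum>i\<in>UNIV. B i i)\<^sup>2 \<le> real CARD('n) * (\<Sum>i\<in>UNIV. \<Sum>l\<in>UNIV. (B i l)\<^sup>2)"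
proof -
  have "(\<Sum>i\<in>UNIV. B i i)\<^sup>2 \<le> real CARD('n) * (\<Sum>i\<in>UNIV. (B i i)\<^sup>2)"
    using Cauchy_Schwarz_ineq_sum[of "\<lambda>_. 1" "\<lambda>i. B i i" UNIV] by simp
  also have "\<dots> \<le> real CARD('n) * (\<Sum>i\<in>UNIV. \<Sum>l\<in>UNIV. (B i l)\<^sup>2)"
    by (intro mult_left_mono sum_mono member_le_sum) auto
  finally show ?thesis .
qed

text \<open>
  Both sides are \<open>tr (D M D M)\<close> with \<open>M = A A\<^sup>T\<close>, in the notation of the introduction.
\<close>

lemma gram_hadamard_frobenius:
  fixes c :: "real^'n" and v :: "'m::finite \<Rightarrow> real^'n"
  shows "(\<Sum>i\<in>UNIV. \<Sum>l\<in>UNIV. (\<Sum>j\<in>UNIV. c $ j * v i $ j * v l $ j)\<^sup>2)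
       = (\<Sum>j\<in>UNIV. \<Sum>k\<in>UNIV. c $ j * c $ k * (\<Sum>i\<in>UNIV. v i $ j * v i $ k)\<^sup>2)"
proof -
  let ?t = "\<lambda>i l j k. c $ j * c $ k * (v i $ j * v i $ k) * (v l $ j * v l $ k)"
  have "(\<Sum>i\<in>UNIV. \<Sum>l\<in>UNIV. (\<Sum>j\<in>UNIV. c $ j * v i $ j * v l $ j)\<^sup>2)
      = (\<Sum>i\<in>UNIV. \<Sum>l\<in>UNIV. \<Sum>j\<in>UNIV. \<Sum>k\<in>UNIV. ?t i l j k)"
    by (simp add: power2_eq_square sum_product mult_ac)
  also have "\<dots> = (\<Sum>i\<in>UNIV. \<Sum>j\<in>UNIV. \<Sum>l\<in>UNIV. \<Sum>k\<in>UNIV. ?t i l j k)"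
    by (intro sum.cong refl sum.swap)
  also have "\<dots> = (\<Sum>j\<in>UNIV. \<Sum>i\<in>UNIV. \<Sum>l\<in>UNIV. \<Sum>k\<in>UNIV. ?t i l j k)"
    by (rule sum.swap)
  also have "\<dots> = (\<Sum>j\<in>UNIV. \<Sum>i\<in>UNIV. \<Sum>k\<in>UNIV. \<Sum>l\<in>UNIV. ?t i l j k)"
    by (intro sum.cong refl sum.swap)
  also have "\<dots> = (\<Sum>j\<in>UNIV. \<Sum>k\<in>UNIV. \<Sum>i\<in>UNIV. \<Sum>l\<in>UNIV. ?t i l j k)"
    by (intro sum.cong refl sum.swap)
  also have "\<dots> = (\<Sum>j\<in>UNIV. \<Sum>k\<in>UNIV. c $ j * c $ k * (\<Sum>i\<in>UNIV. v i $ j * v i $ k)\<^sup>2)"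
    by (simp add: power2_eq_square sum_product sum_distrib_left mult_ac)
  finally show ?thesis .
qed

theorem corollary2:
  fixes M :: "real^'n^'n"
  assumes "psd M"
    and "\<And>j. M $ j $ j = 1"
  shows "M \<circ>\<^sub>H M \<succeq> (1 / real CARD('n)) *\<^sub>R ones_matrix"
proof -
  let ?n = "real CARD('n)"
  let ?N = "M \<circ>\<^sub>H M - (1 / ?n) *\<^sub>R ones_matrix"
  obtain v :: "'n \<Rightarrow> real^'n" where v: "\<And>j k. M $ j $ k = (\<Sum>i\<in>UNIV. v i $ j * v i $ k)"
    using psd_gram[OF assms(1)] by blast
  have "transpose ?N = ?N"
    using psd_symD[OF assms(1)] by (simp add: vec_eq_iff transpose_def hadamard_def ones_matrix_def)
  moreover have "0 \<le> c \<bullet> (?N *v c)" for c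
  proof -
    define B where "B i l = (\<Sum>j\<in>UNIV. c $ j * v i $ j * v l $ j)" for i l
    have "(\<Sum>i\<in>UNIV. B i i) = (\<Sum>j\<in>UNIV. c $ j * M $ j $ j)"
      unfolding B_def v by (subst sum.swap) (simp add: sum_distrib_left mult_ac)
    then have trace: "(\<Sum>i\<in>UNIV. B i i) = (\<Sum>j\<in>UNIV. c $ j)"
      by (simp add: assms(2))
    have frobenius: "(\<Sum>i\<in>UNIV. \<Sum>l\<in>UNIV. (B i l)\<^sup>2)
        = (\<Sum>j\<in>UNIV. \<Sum>k\<in>UNIV. c $ j * c $ k * (M $ j $ k)\<^sup>2)"
      unfolding B_def v by (rule gram_hadamard_frobenius)
    have "c \<bullet> (?N *v c)
        = (\<Sum>j\<in>UNIV. \<Sum>k\<in>UNIV. c $ j * c $ k * (M $ j $ k)\<^sup>2) - (\<Sum>j\<in>UNIV. c $ j)\<^sup>2 / ?n"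
      unfolding inner_matrix_vector_sum
      by (simp add: hadamard_def ones_matrix_def right_diff_distrib sum_subtractf
          power2_eq_square sum_product sum_divide_distrib)
    also have "\<dots> \<ge> 0"
      using trace_square_le_frobenius[of B] unfolding trace frobenius
      by (simp add: divide_le_eq mult.commute)
    finally show ?thesis .
  qed
  ultimately show ?thesis
    unfolding psd_ge_def psd_def by blast
qed

end
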